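(* Let $G^0$ be a (directed) cycle graph on a vertex set $V=\{1,\dots,v\}$ with adjacency matrix $A^0$, and let $G$ be a (directed) cycle graph on the same vertex set $V$ with adjacency matrix $A$. Then there exists a $v\times v$ permutation matrix $X$ such that $$A = X^{\top} A^0 X .$$
   Context: Graphs are directed, without self-loops. The adjacency matrix of a directed graph on $\{1,\dots,v\}$ is the $v\times v$ $0$--$1$ matrix whose $[i,j]$ entry is $1$ if and only if the directed edge $(i,j)$ is present. A cycle graph is a directed graph that is itself a single cycle: a closed tour through all $v$ vertices ($v\ge 2$), following edge directions, with no repeated vertices other than the coinciding start and end vertex; its edges are exactly the edges of this cycle, so every vertex has in-degree $1$ and out-degree $1$. *)

theory Defs
  imports "Graph_Theory.Pair_Digraph" "Jordan_Normal_Form.Matrix"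
begin

text \<open>A digraph that is itself a single directed cycle: some cycle \<open>p\<close> (a closed arc walk with no
  repeated vertex other than its coinciding endpoints) visits every vertex and uses every arc. The
  vertices of a closed walk are the tails of its arcs. \<open>pair_digraph\<close> makes the graph finite and
  loop-free.\<close>

definition cycle_graph :: "'a pair_pre_digraph \<Rightarrow> bool" where
  "cycle_graph G \<longleftrightarrow> pair_digraph G \<and> 2 \<le> card (pverts G) \<and>
    (\<exists>p. pre_digraph.cycle (with_proj G) p \<and> fst ` set p = pverts G \<and> set p = parcs G)"

text \<open>Matrix indices start at \<open>0\<close>, whereas the vertices are \<open>1, \<dots>, v\<close>; hence the shift.\<close>

definition adjacency_matrix :: "nat \<Rightarrow> nat pair_pre_digraph \<Rightarrow> 'a :: zero_neq_one mat" where
  "adjacency_matrix v G = mat v v (\<lambda>(i, j). if (Suc i, Suc j) \<in> parcs G then 1 else 0)"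

definition permutation_matrix :: "nat \<Rightarrow> 'a :: zero_neq_one mat \<Rightarrow> bool" where
  "permutation_matrix n X \<longleftrightarrow> X \<in> carrier_mat n n \<and>
    (\<forall>i<n. \<forall>j<n. X $$ (i, j) \<in> {0, 1}) \<and>
    (\<forall>i<n. \<exists>!j. j < n \<and> X $$ (i, j) = 1) \<and>
    (\<forall>j<n. \<exists>!i. i < n \<and> X $$ (i, j) = 1)"

end

theory Submission
  imports Defs
begin

text \<open>Listing the vertices of a directed cycle of length \<open>n\<close> in the order of traversal identifies it
  with the successor relation of the integers modulo \<open>n\<close>. Hence any two cycles of equal length are
  isomorphic, and conjugating an adjacency matrix by the permutation matrix of an isomorphism
  relabels its vertices.\<close>

text \<open>The enumeration sends \<open>k\<close> to the tail of the \<open>k\<close>-th arc of the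
  cycle. Each head is the next tail, and the last arc returns to the first tail, whence the
  \<open>mod n\<close>.\<close>

lemma cycle_graph_enum:
  assumes "cycle_graph G" and n: "n = card (pverts G)"
  obtains f where "bij_betw f {..<n} (pverts G)"
    and "parcs G = (\<lambda>k. (f k, f (Suc k mod n))) ` {..<n}"
proof -
  from assms(1) obtain p where "pair_digraph G" and cyc: "pre_digraph.cycle (with_proj G) p"
    and verts: "fst ` set p = pverts G" and arcs: "set p = parcs G"
    by (auto simp: cycle_graph_def)
  interpret pair_digraph G by fact
  from cyc obtain u where walk: "pcas u p u" and dist: "distinct (tl (pawalk_verts u p))"
    and ne: "p \<noteq> []"
    by (auto simp: cycle_def awalk_def)
  have tails: "pawalk_verts u p = map fst p @ [snd (last p)]"
    using awalk_verts_conv[of u p] ne by simp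
  have heads: "pawalk_verts u p = fst (hd p) # map snd p"
    using awalk_verts_conv'[OF walk] ne by simp
  have hd_u: "fst (hd p) = u" using walk ne by (cases p) auto
  have "snd (last q) = w'" if "pcas w q w'" "q \<noteq> []" for w w' and q :: "('a \<times> 'a) list"
    using that by (induct q arbitrary: w) (auto split: if_splits)
  then have last_u: "snd (last p) = u" using walk ne by blast
  \<comment> \<open>Both sides are the vertex list of the closed walk, read off once from the heads
    and once from the tails.\<close>
  have rot: "u # map snd p = map fst p @ [u]"
    using tails heads hd_u last_u by simp
  \<comment> \<open>The definition of a cycle gives distinctness after dropping the first vertex,
    that is, for the heads. Cancelling \<open>u\<close> in \<open>rot\<close> carries it over to the
    tails.\<close>
  have "mset (map fst p) = mset (map snd p)"
    using arg_cong[OF rot, of mset] by simp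
  moreover have "distinct (map snd p)" using dist heads by simp
  ultimately have dfst: "distinct (map fst p)" by (metis mset_eq_imp_distinct_iff)
  have len: "length p = n"
    using distinct_card[OF dfst] verts n by simp
  let ?f = "\<lambda>k. fst (p ! k)"
  have next_arc: "p ! k = (?f k, ?f (Suc k mod n))" if k: "k < n" for k
  proof -
    have "snd (p ! k) = (u # map snd p) ! Suc k" using k len by simp
    also have "\<dots> = (map fst p @ [u]) ! Suc k" by (simp only: rot)
    also have "\<dots> = ?f (Suc k mod n)"
    \<comment> \<open>For \<open>Suc k = n\<close> the entry is the appended \<open>u\<close>, which
      is also the tail of arc \<open>0\<close>, in accordance with
      \<open>n mod n = 0\<close>.\<close>
    proof (cases "Suc k < n")
      case True
      then show ?thesis using len by (simp add: nth_append)
    next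
      case False
      then have "Suc k = n" using k by simp
      then show ?thesis using len hd_u ne by (simp add: nth_append hd_conv_nth)
    qed
    finally show ?thesis by (simp add: prod_eq_iff)
  qed
  have set_p: "set p = (!) p ` {..<n}"
    using len by (auto simp: set_conv_nth image_def)
  have "bij_betw ?f {..<n} (pverts G)"
    using bij_betw_nth[OF dfst, of "{..<n}" "pverts G"] verts len
    by (auto simp: bij_betw_def inj_on_def)
  moreover have "parcs G = (\<lambda>k. (?f k, ?f (Suc k mod n))) ` {..<n}"
    unfolding arcs[symmetric] set_p by (rule image_cong[OF refl], rule next_arc) simp
  ultimately show thesis using that by blast
qed

lemma cycle_graphs_isomorphic:
  assumes "cycle_graph G" and "cycle_graph H" and card: "card (pverts G) = card (pverts H)"
  obtains g where "bij_betw g (pverts G) (pverts H)"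
    and "\<And>x y. x \<in> pverts G \<Longrightarrow> y \<in> pverts G \<Longrightarrow> (g x, g y) \<in> parcs H \<longleftrightarrow> (x, y) \<in> parcs G"
proof -
  define n where "n = card (pverts G)"
  obtain f where f: "bij_betw f {..<n} (pverts G)"
    and arcs_G: "parcs G = (\<lambda>k. (f k, f (Suc k mod n))) ` {..<n}"
    using cycle_graph_enum[OF assms(1) n_def] by blast
  obtain h where h: "bij_betw h {..<n} (pverts H)"
    and arcs_H: "parcs H = (\<lambda>k. (h k, h (Suc k mod n))) ` {..<n}"
    using cycle_graph_enum[OF assms(2)] card n_def by metis
  let ?g = "h \<circ> inv_into {..<n} f"
  have g_f: "?g (f k) = h k" if "k < n" for k
    using f that by (simp add: bij_betw_def)
  \<comment> \<open>By injectivity only the index \<open>k = i\<close> can produce an arc with tail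
    \<open>e i\<close>. The criterion does not mention \<open>e\<close>, so it matches arcs under
    \<open>f\<close> with arcs under \<open>h\<close>.\<close>
  have arc_iff: "(e i, e j) \<in> (\<lambda>k. (e k, e (Suc k mod n))) ` {..<n} \<longleftrightarrow> j = Suc i mod n"
    if e: "inj_on e {..<n}" and "i < n" "j < n" for e :: "nat \<Rightarrow> 'c" and i j
  proof -
    have "Suc k mod n < n" for k using \<open>i < n\<close> by simp
    then show ?thesis using that by (auto simp: inj_on_eq_iff[OF e])
  qed
  have "(?g x, ?g y) \<in> parcs H \<longleftrightarrow> (x, y) \<in> parcs G"
    if xy: "x \<in> pverts G" "y \<in> pverts G" for x y
  proof -
    from xy have "x \<in> f ` {..<n}" "y \<in> f ` {..<n}" using f by (simp_all add: bij_betw_def)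
    then obtain i j where ij: "i < n" "j < n" "x = f i" "y = f j" by blast
    then show ?thesis
      unfolding arcs_G arcs_H ij(3,4) g_f[OF ij(1)] g_f[OF ij(2)]
      using f h arc_iff[of f i j] arc_iff[of h i j] by (simp add: bij_betw_def)
  qed
  moreover have "bij_betw ?g (pverts G) (pverts H)"
    using bij_betw_trans[OF bij_betw_inv_into[OF f] h] .
  ultimately show thesis using that by blast
qed

text \<open>Column \<open>j\<close> is the unit vector at \<open>h j\<close>; with this orientation
  the conjugation below involves \<open>h\<close> itself and not its inverse.\<close>

definition matrix_of_perm :: "nat \<Rightarrow> (nat \<Rightarrow> nat) \<Rightarrow> 'a :: zero_neq_one mat" where
  "matrix_of_perm n h = mat n n (\<lambda>(i, j). if i = h j then 1 else 0)"

lemma permutation_matrix_of_perm: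
  assumes "bij_betw h {..<n} {..<n}"
  shows "permutation_matrix n (matrix_of_perm n h)"
proof -
  have "\<exists>!j. j < n \<and> i = h j" if "i < n" for i
    using assms that unfolding bij_betw_def inj_on_def by (metis imageE imageI lessThan_iff)
  moreover have "h j < n" if "j < n" for j
    using assms that by (auto simp: bij_betw_def)
  ultimately show ?thesis
    unfolding permutation_matrix_def matrix_of_perm_def
    by (auto cong: conj_cong split: if_splits) blast
qed

text \<open>Multiplying by the transpose on the left selects rows and multiplying on the right
  selects columns: each sum collapses to the single term at \<open>h i\<close> or
  \<open>h j\<close>.\<close>

lemma conjugate_matrix_of_perm:
  fixes A :: "'a :: semiring_1 mat"
  assumes h: "\<And>j. j < n \<Longrightarrow> h j < n" and A: "A \<in> carrier_mat n n"
  shows "transpose_mat (matrix_of_perm n h) * A * matrix_of_perm n h =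
    mat n n (\<lambda>(i, j). A $$ (h i, h j))"
proof -
  let ?X = "matrix_of_perm n h :: 'a mat"
  have X: "?X \<in> carrier_mat n n" by (simp add: matrix_of_perm_def)
  have left: "(transpose_mat ?X * A) $$ (i, k) = A $$ (h i, k)" if "i < n" "k < n" for i k
    using that A h[of i]
    by (simp add: matrix_of_perm_def scalar_prod_def if_distrib[of "\<lambda>x. x * _"] cong: if_cong)
  have "(transpose_mat ?X * A * ?X) $$ (i, j) = A $$ (h i, h j)" if "i < n" "j < n" for i j
  proof -
    \<comment> \<open>An opaque \<open>B\<close> lets only the outer product be expanded, so that
      \<open>left\<close> applies to the inner one.\<close>
    have "(B * ?X) $$ (i, j) = (\<Sum>k\<in>{0..<n}. B $$ (i, k) * ?X $$ (k, j))"
      if "B \<in> carrier_mat n n" for B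
      using that \<open>i < n\<close> \<open>j < n\<close> X by (simp add: scalar_prod_def)
    then have "(transpose_mat ?X * A * ?X) $$ (i, j) =
        (\<Sum>k\<in>{0..<n}. (transpose_mat ?X * A) $$ (i, k) * ?X $$ (k, j))"
      using A X by (meson mult_carrier_mat transpose_carrier_mat)
    also have "\<dots> = (\<Sum>k\<in>{0..<n}. if k = h j then A $$ (h i, k) else 0)"
      using that by (intro sum.cong) (auto simp: left, auto simp: matrix_of_perm_def)
    finally show ?thesis using h that by simp
  qed
  then show ?thesis using A X by (intro eq_matI) auto
qed

theorem proposition3p1:
  fixes v :: nat
    and G0 G :: "nat pair_pre_digraph"
    and A0 A :: "real mat"
  assumes "pverts G0 = {1..v}" and "cycle_graph G0" and "A0 = adjacency_matrix v G0"
    and "pverts G = {1..v}" and "cycle_graph G" and "A = adjacency_matrix v G"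
  shows "\<exists>X :: real mat. permutation_matrix v X \<and>
           A = transpose_mat X * A0 * X"
proof -
  \<comment> \<open>The isomorphism runs from \<open>G\<close> to \<open>G0\<close>, because entries
    of \<open>A\<close> are to be read off from \<open>A0\<close>.\<close>
  obtain g where g: "bij_betw g {1..v} {1..v}"
    and iso: "\<And>x y. x \<in> {1..v} \<Longrightarrow> y \<in> {1..v} \<Longrightarrow> (g x, g y) \<in> parcs G0 \<longleftrightarrow> (x, y) \<in> parcs G"
    using cycle_graphs_isomorphic[OF assms(5,2)] assms(1,4) by metis
  \<comment> \<open>This is \<open>g\<close> moved to matrix indices starting at \<open>0\<close>.
    The subtraction never truncates for \<open>i < v\<close>, since \<open>g\<close> takes values in
    \<open>{1..v}\<close> there.\<close>
  define h where "h i = g (Suc i) - 1" for i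
  have Suc_bij: "bij_betw Suc {..<v} {1..v}"
    by (simp add: bij_betw_def image_Suc_lessThan)
  have pred_bij: "bij_betw (\<lambda>i. i - 1) {1..v} {..<v}"
    by (rule bij_betw_byWitness[where f' = Suc]) auto
  have "h = (\<lambda>i. i - 1) \<circ> g \<circ> Suc" by (simp add: fun_eq_iff h_def)
  then have h: "bij_betw h {..<v} {..<v}"
    using bij_betw_trans[OF bij_betw_trans[OF Suc_bij g] pred_bij] by (simp add: comp_assoc)
  have h_less: "h i < v" if "i < v" for i
    using bij_betw_apply[OF h] that by auto
  have Suc_h: "Suc (h i) = g (Suc i)" if "i < v" for i
    using bij_betw_apply[OF g, of "Suc i"] that by (simp add: h_def)
  have A0: "A0 \<in> carrier_mat v v" using assms(3) by (simp add: adjacency_matrix_def)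
  have "A = mat v v (\<lambda>(i, j). A0 $$ (h i, h j))"
    unfolding assms(3,6) adjacency_matrix_def
    by (rule eq_matI) (simp_all add: h_less Suc_h iso)
  then have "A = transpose_mat (matrix_of_perm v h) * A0 * matrix_of_perm v h"
    using conjugate_matrix_of_perm[OF h_less A0] by simp
  then show ?thesis using permutation_matrix_of_perm[OF h] by blast
qed

end
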